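(* Let $p$ and $q$ be distinct prime numbers. The zero divisor graph $\Gamma[\mathbb{Z}_{pq}]$ is an Euler graph if and only if $p$ and $q$ are both odd.
   Context: For a commutative ring $R$ with unity, let $Z[R]$ be the set of its zero divisors. The zero divisor graph $\Gamma[R]$ is the undirected graph with vertex set $Z^*[R]=Z[R]\setminus\{0\}$ (the non-zero zero divisors of $R$), in which two distinct vertices $v,w$ are adjacent if and only if $vw=0$ (there are no loops). $\mathbb{Z}_n$ denotes the ring of integers modulo $n$. An Euler tour of a graph $G$ is a tour (closed walk) that includes each edge of $G$ exactly once. A graph $G$ is called an Euler graph (or Eulerian) if it has an Euler tour. *)

theory Defs
  imports "HOL-Number_Theory.Residues" "Graph_Theory.Graph_Theory"
begin

text \<open>Zero counts as a zero divisor of every nontrivial ring; it is excluded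
  only when the vertex set of the graph is formed.\<close>

definition zero_divisors :: "('a, 'm) ring_scheme \<Rightarrow> 'a set" where
  "zero_divisors R =
     {a \<in> carrier R. \<exists>b \<in> carrier R. b \<noteq> \<zero>\<^bsub>R\<^esub> \<and> a \<otimes>\<^bsub>R\<^esub> b = \<zero>\<^bsub>R\<^esub>}"

text \<open>Undirected graphs are encoded as in Graph-Theory, as symmetric sets of arcs. For a
  commutative ring the arc set below is symmetric, and it is loop-free by definition.\<close>

definition zero_divisor_graph :: "('a, 'm) ring_scheme \<Rightarrow> 'a pair_pre_digraph" where
  "zero_divisor_graph R =
     (let V = zero_divisors R - {\<zero>\<^bsub>R\<^esub>}
      in \<lparr>pverts = V,
          parcs = {(v, w). v \<in> V \<and> w \<in> V \<and> v \<noteq> w \<and> v \<otimes>\<^bsub>R\<^esub> w = \<zero>\<^bsub>R\<^esub>}\<rparr>)"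

definition arc_edge :: "'a \<times> 'a \<Rightarrow> 'a set" where
  "arc_edge a = {fst a, snd a}"

text \<open>The arcs \<open>(v, w)\<close> and \<open>(w, v)\<close> are the two directions of one undirected edge, and a tour
  has to use exactly one of them. The constant \<open>pre_digraph.euler_trail\<close> of the library is
  the directed notion, which would traverse every edge in both directions.\<close>

definition euler_tour :: "'a pair_pre_digraph \<Rightarrow> 'a \<Rightarrow> ('a \<times> 'a) awalk \<Rightarrow> bool" where
  "euler_tour G u p \<longleftrightarrow>
     pre_digraph.awalk (with_proj G) u p u \<and>
     (\<forall>e \<in> arc_edge ` parcs G. count_list (map arc_edge p) e = 1)"

definition euler_graph :: "'a pair_pre_digraph \<Rightarrow> bool" where
  "euler_graph G \<longleftrightarrow> (\<exists>u p. euler_tour G u p)"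

end

theory Submission
  imports Defs
begin

text \<open>
  The nonzero zero divisors of \<open>\<int>\<^sub>p\<^sub>q\<close> are the residues divisible by exactly one of the two primes.
  If \<open>A\<close> is the set of nonzero multiples of \<open>p\<close> and \<open>B\<close> that of \<open>q\<close>, then \<open>A\<close> and \<open>B\<close> are disjoint,
  a product of two vertices vanishes iff one factor supplies \<open>p\<close> and the other \<open>q\<close>, and so the zero
  divisor graph is complete bipartite with sides of size \<open>q - 1\<close> and \<open>p - 1\<close>
  (\<open>zero_divisor_graph_residue_ring\<close>, \<open>card_multiples_below\<close>).

  A complete bipartite graph with nonempty sides has an Euler tour iff both sides have even size
  (\<open>complete_bipartite_euler_graph_iff\<close>). The condition is necessary because a closed walk leaves
  a vertex as often as it enters it, which makes every degree even (\<open>euler_tour_even_degree\<close>), and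
  a vertex on one side has the size of the other side as its degree. For sufficiency a
  tour can be written down. Split both sides into pairs. Two vertices \<open>b, b'\<close> on one side form a square \<open>b a b' a' b\<close> with every pair \<open>a, a'\<close> on the
  other side; all these squares are closed at \<open>b\<close>, so they can be walked in succession, and
  starting one of them at \<open>a\<close> instead of \<open>b\<close> turns the whole into a closed walk based at \<open>a\<close>.
  With the same \<open>a\<close> for all pairs \<open>b, b'\<close>, these closed walks can again be concatenated
  (\<open>bipartite_tour\<close>).
\<close>

lemma distinct_iff_count_list: "distinct xs \<longleftrightarrow> (\<forall>x \<in> set xs. count_list xs x = 1)"
  by (induction xs) (auto simp: count_list_0_iff)

section \<open>Euler tours force even degrees\<close>

text \<open>
  Each arc that touches \<open>v\<close> toggles whether the walk currently is at \<open>v\<close>; this uses that no arc is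
  a loop. Hence the parity of the number of these arcs compares the start with the end, and for
  a closed walk it is even.
\<close>

lemma walk_even_incidences:
  assumes "pcas u p w"
    and "\<forall>a \<in> set p. fst a \<noteq> snd a"
  shows "even (length (filter (\<lambda>a. v \<in> arc_edge a) p)) \<longleftrightarrow> (u = v \<longleftrightarrow> w = v)"
  using assms
proof (induction p arbitrary: u)
  case Nil
  then show ?case by auto
next
  case (Cons a p)
  then have "fst a = u" "pcas (snd a) p w" "fst a \<noteq> snd a"
    by auto
  with Cons.IH[of "snd a"] Cons.prems show ?case
    by (auto simp: arc_edge_def)
qed

text \<open>
  A tour lists every edge once, so the edges at \<open>v\<close> correspond to the steps of the tour that
  touch \<open>v\<close>, of which a closed walk has an even number.
\<close>

lemma euler_tour_even_degree:
  assumes tour: "euler_tour G u p"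
    and loopfree: "\<forall>(x, y) \<in> parcs G. x \<noteq> y"
  shows "even (card {e \<in> arc_edge ` parcs G. v \<in> e})"
proof -
  have walk: "pre_digraph.awalk (with_proj G) u p u"
    and once: "\<And>e. e \<in> arc_edge ` parcs G \<Longrightarrow> count_list (map arc_edge p) e = 1"
    using tour by (auto simp: euler_tour_def)
  have cas: "pcas u p u" and arcs: "set p \<subseteq> parcs G"
    using walk by (auto simp: pre_digraph.awalk_def cas_with_proj_eq)
  have edges: "set (map arc_edge p) = arc_edge ` parcs G"
  proof
    show "set (map arc_edge p) \<subseteq> arc_edge ` parcs G" using arcs by auto
    show "arc_edge ` parcs G \<subseteq> set (map arc_edge p)"
    proof
      fix e assume "e \<in> arc_edge ` parcs G"
      then have "count_list (map arc_edge p) e \<noteq> 0" by (simp add: once)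
      then show "e \<in> set (map arc_edge p)" by (simp only: count_list_0_iff not_not)
    qed
  qed
  have "distinct (map arc_edge p)"
    unfolding distinct_iff_count_list edges using once by blast
  then have "card {e \<in> arc_edge ` parcs G. v \<in> e} = length (filter (\<lambda>e. v \<in> e) (map arc_edge p))"
    unfolding edges[symmetric]
    using distinct_card[OF distinct_filter, of "map arc_edge p" "\<lambda>e. v \<in> e"] by simp
  also have "\<dots> = length (filter (\<lambda>a. v \<in> arc_edge a) p)"
    by (simp add: filter_map comp_def)
  finally show ?thesis
    using walk_even_incidences[OF cas, of v] arcs loopfree by (auto simp: split_beta)
qed

section \<open>Complete bipartite graphs\<close>

definition complete_bipartite :: "'a set \<Rightarrow> 'a set \<Rightarrow> 'a pair_pre_digraph" where
  "complete_bipartite A B = \<lparr>pverts = A \<union> B, parcs = A \<times> B \<union> B \<times> A\<rparr>"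

lemma complete_bipartite_commute: "complete_bipartite A B = complete_bipartite B A"
  by (auto simp: complete_bipartite_def)

lemma complete_bipartite_edges:
  "arc_edge ` parcs (complete_bipartite A B) = (\<lambda>(a, b). {a, b}) ` (A \<times> B)"
  by (force simp: complete_bipartite_def arc_edge_def image_iff)

lemma complete_bipartite_degree:
  assumes "A \<inter> B = {}" "a \<in> A"
  shows "card {e \<in> arc_edge ` parcs (complete_bipartite A B). a \<in> e} = card B"
proof -
  have "{e \<in> arc_edge ` parcs (complete_bipartite A B). a \<in> e} = (\<lambda>b. {a, b}) ` B"
    using assms by (auto simp: complete_bipartite_edges)
  moreover have "inj_on (\<lambda>b. {a, b}) B"
    by (auto simp: inj_on_def doubleton_eq_iff)
  ultimately show ?thesis by (simp add: card_image)
qed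

text \<open>
  The walk follows the square \<open>b a b' a' b\<close> for the list entries taken two at a time, so it covers
  the edges from \<open>b\<close> and \<open>b'\<close> to all entries of a list of even length. An odd last entry would be
  dropped.
\<close>

fun squares :: "'a \<Rightarrow> 'a \<Rightarrow> 'a list \<Rightarrow> ('a \<times> 'a) awalk" where
  "squares b b' (a # a' # as) = [(b, a), (a, b'), (b', a'), (a', b)] @ squares b b' as"
| "squares b b' _ = []"

text \<open>
  One side of the graph is \<open>a # a' # as\<close>, the other is consumed in pairs \<open>b, b'\<close>. Each round is
  the square \<open>a b a' b' a\<close>, interrupted at \<open>b\<close> by the squares through the vertices in \<open>as\<close>. It
  returns to \<open>a\<close>, where the next round can start.
\<close>

fun bipartite_tour :: "'a \<Rightarrow> 'a \<Rightarrow> 'a list \<Rightarrow> 'a list \<Rightarrow> ('a \<times> 'a) awalk" where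
  "bipartite_tour a a' as (b # b' # bs) =
     (a, b) # squares b b' as @ [(b, a'), (a', b'), (b', a)] @ bipartite_tour a a' as bs"
| "bipartite_tour a a' as _ = []"

lemma cas_squares_append: "pcas b (squares b b' as @ p) w \<longleftrightarrow> pcas b p w"
  by (induction b b' as rule: squares.induct) simp_all

lemma cas_bipartite_tour: "pcas a (bipartite_tour a a' as bs) a"
  by (induction a a' as bs rule: bipartite_tour.induct) (simp_all add: cas_squares_append)

text \<open>
  Equality of multisets, rather than of sets, records that no edge is repeated, and it is
  insensitive to the order in which the walk meets the edges.
\<close>

lemma mset_squares:
  assumes "even (length as)"
  shows "image_mset arc_edge (mset (squares b b' as)) =
    {#{a, b}. a \<in># mset as#} + {#{a, b'}. a \<in># mset as#}"
  using assms
proof (induction b b' as rule: squares.induct)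
  case (1 b b' a a' as)
  have "arc_edge (b, a) = {a, b}" "arc_edge (a, b') = {a, b'}"
    "arc_edge (b', a') = {a', b'}" "arc_edge (a', b) = {a', b}"
    by (auto simp: arc_edge_def)
  with 1 show ?case by simp
qed simp_all

lemma mset_bipartite_tour:
  assumes "even (length as)" "even (length bs)"
  shows "image_mset arc_edge (mset (bipartite_tour a a' as bs)) =
    {#{a, b}. (b, a) \<in># mset (List.product bs (a # a' # as))#}"
  using assms
proof (induction a a' as bs rule: bipartite_tour.induct)
  case (1 a a' as b b' bs)
  have "arc_edge (a, b) = {a, b}" "arc_edge (b, a') = {a', b}"
    "arc_edge (a', b') = {a', b'}" "arc_edge (b', a) = {a, b'}"
    by (auto simp: arc_edge_def)
  with 1 show ?case
    by (simp add: mset_squares multiset.map_comp comp_def)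
qed simp_all

lemma set_squares:
  assumes "b \<in> B" "b' \<in> B" "set as \<subseteq> A"
  shows "set (squares b b' as) \<subseteq> A \<times> B \<union> B \<times> A"
  using assms by (induction b b' as rule: squares.induct) simp_all

lemma set_bipartite_tour:
  assumes "set (a # a' # as) \<subseteq> A" "set bs \<subseteq> B"
  shows "set (bipartite_tour a a' as bs) \<subseteq> A \<times> B \<union> B \<times> A"
  using assms by (induction a a' as bs rule: bipartite_tour.induct) (simp_all add: set_squares)

lemma complete_bipartite_euler_graph:
  assumes fin: "finite A" "finite B" and disj: "A \<inter> B = {}" and ne: "A \<noteq> {}"
    and even: "even (card A)" "even (card B)"
  shows "euler_graph (complete_bipartite A B)"
proof -
  \<comment> \<open>As \<open>A\<close> has a positive even number of elements, a list of them starts with two entries.\<close>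
  obtain as0 where as0: "set as0 = A" "distinct as0"
    using fin finite_distinct_list by blast
  obtain bs where bs: "set bs = B" "distinct bs"
    using fin finite_distinct_list by blast
  have len: "even (length as0)" "even (length bs)" "as0 \<noteq> []"
    using as0 bs even ne distinct_card[of as0] distinct_card[of bs] by auto
  then obtain a a' as where as: "as0 = a # a' # as"
    by (cases as0; cases "tl as0") auto
  let ?p = "bipartite_tour a a' as bs"
  have walk: "pre_digraph.awalk (with_proj (complete_bipartite A B)) a ?p a"
    unfolding pre_digraph.awalk_def cas_with_proj_eq
    using as0 bs as set_bipartite_tour[of a a' as A bs B]
    by (simp add: complete_bipartite_def cas_bipartite_tour) auto
  have mset: "mset (map arc_edge ?p) = mset (map (\<lambda>(b, a). {a, b}) (List.product bs as0))"
    using mset_bipartite_tour[of as bs a a'] len unfolding as by simp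
  \<comment> \<open>Disjointness of the sides lets an unordered edge determine its two ends.\<close>
  have "inj_on (\<lambda>(b, a). {a, b}) (B \<times> A)"
    using disj by (auto simp: inj_on_def doubleton_eq_iff)
  then have "distinct (map (\<lambda>(b, a). {a, b}) (List.product bs as0))"
    using as0 bs by (simp add: distinct_map distinct_product)
  then have dist: "distinct (map arc_edge ?p)"
    using mset_eq_imp_distinct_iff[OF mset] by blast
  have "set (map arc_edge ?p) = (\<lambda>(b, a). {a, b}) ` (B \<times> A)"
    using mset_eq_setD[OF mset] as0 bs by simp
  also have "\<dots> = arc_edge ` parcs (complete_bipartite A B)"
    by (force simp: complete_bipartite_edges)
  finally have "\<forall>e \<in> arc_edge ` parcs (complete_bipartite A B). count_list (map arc_edge ?p) e = 1"
    using dist unfolding distinct_iff_count_list by simp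
  with walk show ?thesis unfolding euler_graph_def euler_tour_def by blast
qed

theorem complete_bipartite_euler_graph_iff:
  assumes "finite A" "finite B" "A \<inter> B = {}" "A \<noteq> {}" "B \<noteq> {}"
  shows "euler_graph (complete_bipartite A B) \<longleftrightarrow> even (card A) \<and> even (card B)"
proof
  assume "euler_graph (complete_bipartite A B)"
  then obtain u p where "euler_tour (complete_bipartite A B) u p"
    by (auto simp: euler_graph_def)
  then have deg: "even (card {e \<in> arc_edge ` parcs (complete_bipartite A B). v \<in> e})" for v
    using assms by (intro euler_tour_even_degree) (auto simp: complete_bipartite_def)
  obtain a b where "a \<in> A" "b \<in> B" using assms by auto
  then show "even (card A) \<and> even (card B)"
    using deg[of a] deg[of b] assms(3) complete_bipartite_degree[of A B a]
      complete_bipartite_degree[of B A b]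
    by (simp add: complete_bipartite_commute[of B A] Int_commute)
qed (use assms complete_bipartite_euler_graph in blast)

section \<open>The zero divisor graph of the integers modulo pq\<close>

definition multiples_below :: "int \<Rightarrow> int \<Rightarrow> int set" where
  "multiples_below d n = {x. 0 < x \<and> x < n \<and> d dvd x}"

lemma card_multiples_below:
  fixes d k :: nat
  assumes "0 < d"
  shows "card (multiples_below (int d) (int (d * k))) = k - 1"
proof -
  have "multiples_below (int d) (int (d * k)) = (\<lambda>i. int d * i) ` {0<..<int k}"
    using assms by (auto simp: multiples_below_def dvd_def zero_less_mult_iff)
  moreover have "inj_on (\<lambda>i. int d * i) {0<..<int k}"
    using assms by (auto simp: inj_on_def)
  ultimately show ?thesis by (simp add: card_image)
qed

lemma finite_multiples_below: "finite (multiples_below d n)"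
  by (rule finite_subset[of _ "{0..n}"]) (auto simp: multiples_below_def)

lemma prime_mult_dvd_int_iff:
  fixes p q :: nat
  assumes "prime p" "prime q" "p \<noteq> q"
  shows "int (p * q) dvd x \<longleftrightarrow> int p dvd x \<and> int q dvd x"
proof -
  have "coprime (int p) (int q)"
    using assms primes_coprime by simp
  then show ?thesis
    by (auto intro: divides_mult dvd_trans[of "int p" "int p * int q"]
        dvd_trans[of "int q" "int p * int q"])
qed

text \<open>
  A residue strictly between \<open>0\<close> and \<open>pq\<close> cannot be divisible by both primes. So if \<open>pq\<close> divides a
  product of two such residues, each prime divides exactly one factor, and not the same one.
  Every multiple of \<open>p\<close> is a zero divisor because \<open>q\<close> annihilates it, and vice versa.
\<close>

lemma zero_divisor_graph_residue_ring:
  fixes p q :: nat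
  assumes p: "prime p" and q: "prime q" and pq: "p \<noteq> q"
  defines "n \<equiv> int (p * q)"
  defines "A \<equiv> multiples_below (int p) n" and "B \<equiv> multiples_below (int q) n"
  shows "zero_divisor_graph (residue_ring n) = complete_bipartite A B" and "A \<inter> B = {}"
proof -
  have n_dvd: "n dvd x \<longleftrightarrow> int p dvd x \<and> int q dvd x" for x
    unfolding n_def by (rule prime_mult_dvd_int_iff[OF p q pq])
  have small: "\<not> n dvd x" if "0 < x" "x < n" for x
    using that zdvd_not_zless by blast
  have pp: "prime (int p)" "prime (int q)" using p q by auto
  have pos: "0 < p" "0 < q" "1 < p" "1 < q" using p q prime_gt_1_nat prime_gt_0_nat by auto
  show disj: "A \<inter> B = {}"
    using small n_dvd by (auto simp: A_def B_def multiples_below_def)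
  have product_zero: "n dvd x * y \<longleftrightarrow> x \<in> A \<and> y \<in> B \<or> x \<in> B \<and> y \<in> A"
    if "0 < x" "x < n" "0 < y" "y < n" for x y
    using that small[of x] small[of y] n_dvd
    by (auto simp: A_def B_def multiples_below_def prime_dvd_mult_iff[OF pp(1)]
        prime_dvd_mult_iff[OF pp(2)])
  have "int p \<in> A" "int q \<in> B"
    using pos by (auto simp: A_def B_def n_def multiples_below_def)
  have in_range: "A \<subseteq> {0<..<n}" "B \<subseteq> {0<..<n}"
    by (auto simp: A_def B_def multiples_below_def)
  have ring: "carrier (residue_ring n) = {0..<n}" "\<zero>\<^bsub>residue_ring n\<^esub> = 0"
    "x \<otimes>\<^bsub>residue_ring n\<^esub> y = (x * y) mod n" for x y
    by (auto simp: residue_ring_def)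
  have nonneg: "0 < z \<longleftrightarrow> 0 \<le> z \<and> z \<noteq> 0" for z :: int
    by auto
  have zero_divisor_iff: "x \<in> zero_divisors (residue_ring n) - {0} \<longleftrightarrow>
      0 < x \<and> x < n \<and> (\<exists>y. 0 < y \<and> y < n \<and> n dvd x * y)" for x
    unfolding zero_divisors_def ring nonneg mod_eq_0_iff_dvd by auto
  have verts: "zero_divisors (residue_ring n) - {0} = A \<union> B"
  proof (intro equalityI subsetI)
    fix x assume "x \<in> zero_divisors (residue_ring n) - {0}"
    then obtain y where "0 < x" "x < n" "0 < y" "y < n" "n dvd x * y"
      unfolding zero_divisor_iff by blast
    then show "x \<in> A \<union> B" using product_zero by blast
  next
    fix x assume x: "x \<in> A \<union> B"
    then obtain y where y: "y \<in> A \<union> B" "x \<in> A \<and> y \<in> B \<or> x \<in> B \<and> y \<in> A"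
      using \<open>int p \<in> A\<close> \<open>int q \<in> B\<close> by blast
    have "x \<in> {0<..<n}" "y \<in> {0<..<n}" using x y(1) in_range by blast+
    then have "0 < x" "x < n" "0 < y" "y < n" by simp_all
    moreover from this have "n dvd x * y" using product_zero[of x y] y(2) by simp
    ultimately show "x \<in> zero_divisors (residue_ring n) - {0}"
      unfolding zero_divisor_iff by blast
  qed
  have arc_iff: "v \<in> A \<union> B \<and> w \<in> A \<union> B \<and> v \<noteq> w \<and> v * w mod n = 0 \<longleftrightarrow>
      (v, w) \<in> A \<times> B \<union> B \<times> A" for v w
  proof
    assume vw: "v \<in> A \<union> B \<and> w \<in> A \<union> B \<and> v \<noteq> w \<and> v * w mod n = 0"
    then have "v \<in> {0<..<n}" "w \<in> {0<..<n}" using in_range by blast+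
    with vw show "(v, w) \<in> A \<times> B \<union> B \<times> A"
      using product_zero[of v w] by (simp add: mod_eq_0_iff_dvd)
  next
    assume "(v, w) \<in> A \<times> B \<union> B \<times> A"
    then have vw: "v \<in> A \<and> w \<in> B \<or> v \<in> B \<and> w \<in> A" by simp
    then have sides: "v \<in> A \<union> B" "w \<in> A \<union> B" and "v \<noteq> w" using disj by auto
    moreover have "v \<in> {0<..<n}" "w \<in> {0<..<n}" using sides in_range by blast+
    ultimately show "v \<in> A \<union> B \<and> w \<in> A \<union> B \<and> v \<noteq> w \<and> v * w mod n = 0"
      using product_zero[of v w] vw by (simp add: mod_eq_0_iff_dvd)
  qed
  have "{(v, w). v \<in> A \<union> B \<and> w \<in> A \<union> B \<and> v \<noteq> w \<and> v * w mod n = 0} = A \<times> B \<union> B \<times> A"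
    unfolding arc_iff by auto
  then show "zero_divisor_graph (residue_ring n) = complete_bipartite A B"
    unfolding zero_divisor_graph_def complete_bipartite_def ring verts by simp
qed

theorem theorem4p1:
  fixes p q :: nat
  assumes "prime p" and "prime q" and "p \<noteq> q"
  shows "euler_graph (zero_divisor_graph (residue_ring (int (p * q)))) \<longleftrightarrow> odd p \<and> odd q"
proof -
  let ?A = "multiples_below (int p) (int (p * q))"
  let ?B = "multiples_below (int q) (int (p * q))"
  have gt: "1 < p" "1 < q" using assms(1,2) by (simp_all only: prime_gt_1_nat)
  have card: "card ?A = q - 1" "card ?B = p - 1"
    using card_multiples_below[of p q] card_multiples_below[of q p] gt
    by (simp_all only: mult.commute[of q p])
  have "?A \<noteq> {}" "?B \<noteq> {}"
    using card gt by (metis card.empty zero_less_diff less_irrefl)+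
  then have "euler_graph (complete_bipartite ?A ?B) \<longleftrightarrow> even (q - 1) \<and> even (p - 1)"
    using complete_bipartite_euler_graph_iff[OF finite_multiples_below finite_multiples_below
        zero_divisor_graph_residue_ring(2)[OF assms]]
    by (simp only: card simp_thms)
  also have "\<dots> \<longleftrightarrow> odd p \<and> odd q" using gt by auto
  finally show ?thesis
    by (simp only: zero_divisor_graph_residue_ring(1)[OF assms])
qed

end
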